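(* For every positive integer $n$ and every even positive integer $m=2k$, $$N(O(2n),m)=\binom{n+m/2}{m/2}+\binom{n+m/2-1}{m/2}=\binom{n+m/2-1}{m/2}\frac{4n+m}{2n}.$$
   Context: $O(N)$ is the group of real $N\times N$ orthogonal matrices. $N(G,m)$ denotes the number of conjugacy classes of $G$ (under conjugation by elements of $G$) contained in $\{x\in G: x^m=1\}$. *)

theory Defs
  imports "Jordan_Normal_Form.Matrix" "HOL-Algebra.Group_Action"
begin

text \<open>The predicate \<^const>\<open>orthogonal_mat\<close> only says that the columns are nonzero and pairwise
  orthogonal, not that they have norm 1, so it does not describe this group.\<close>

definition orthogonal_group :: "nat \<Rightarrow> real mat monoid" where
  "orthogonal_group N =
    \<lparr>carrier = {A \<in> carrier_mat N N. transpose_mat A * A = 1\<^sub>m N \<and> A * transpose_mat A = 1\<^sub>m N},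
     monoid.mult = (*), one = 1\<^sub>m N\<rparr>"

lemma group_orthogonal_group: "group (orthogonal_group N)"
proof (rule groupI)
  fix A B assume "A \<in> carrier (orthogonal_group N)" "B \<in> carrier (orthogonal_group N)"
  then have A: "A \<in> carrier_mat N N" "transpose_mat A * A = 1\<^sub>m N" "A * transpose_mat A = 1\<^sub>m N"
    and B: "B \<in> carrier_mat N N" "transpose_mat B * B = 1\<^sub>m N" "B * transpose_mat B = 1\<^sub>m N"
    by (auto simp: orthogonal_group_def)
  have T: "transpose_mat (A * B) = transpose_mat B * transpose_mat A"
    using A(1) B(1) by (rule transpose_mult)
  have "transpose_mat B * transpose_mat A * (A * B)
      = transpose_mat B * ((transpose_mat A * A) * B)"
    using A(1) B(1) by (simp add: assoc_mult_mat[of _ N N _ N _ N])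
  moreover have "A * B * (transpose_mat B * transpose_mat A)
      = A * ((B * transpose_mat B) * transpose_mat A)"
    using A(1) B(1) by (simp add: assoc_mult_mat[of _ N N _ N _ N])
  ultimately show "A \<otimes>\<^bsub>orthogonal_group N\<^esub> B \<in> carrier (orthogonal_group N)"
    using A B by (simp add: orthogonal_group_def T)
next
  show "\<one>\<^bsub>orthogonal_group N\<^esub> \<in> carrier (orthogonal_group N)"
    by (simp add: orthogonal_group_def)
next
  fix A assume "A \<in> carrier (orthogonal_group N)"
  then show "\<exists>B\<in>carrier (orthogonal_group N). B \<otimes>\<^bsub>orthogonal_group N\<^esub> A = \<one>\<^bsub>orthogonal_group N\<^esub>"
    by (intro bexI[of _ "transpose_mat A"]) (auto simp: orthogonal_group_def)
qed (auto simp: orthogonal_group_def assoc_mult_mat[of _ N N _ N _ N])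

definition conjugacy_classes :: "('a, 'b) monoid_scheme \<Rightarrow> 'a set set" where
  "conjugacy_classes G =
    orbits G (carrier G) (\<lambda>g. \<lambda>x\<in>carrier G. g \<otimes>\<^bsub>G\<^esub> x \<otimes>\<^bsub>G\<^esub> inv\<^bsub>G\<^esub> g)"

text \<open>A positive value entails finiteness of the set of classes, as \<^const>\<open>card\<close> is \<open>0\<close> on infinite sets.\<close>

definition num_torsion_classes :: "('a, 'b) monoid_scheme \<Rightarrow> nat \<Rightarrow> nat" where
  "num_torsion_classes G m =
    card {C \<in> conjugacy_classes G. C \<subseteq> {x \<in> carrier G. x [^]\<^bsub>G\<^esub> m = \<one>\<^bsub>G\<^esub>}}"

end

theory Submission
  imports Defs "Jordan_Normal_Form.Char_Poly"
begin

text \<open>Two real orthogonal matrices are conjugate in \<open>O(N)\<close> iff their characteristic polynomials agree: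
  a common complex eigenvalue \<open>z\<close> yields, in both, an invariant line (\<open>z\<close> real) or plane (\<open>z\<close> not
  real) on which they act by the same block, and one cancels it and recurses on the orthogonal
  complement. If moreover the \<open>m\<close>-th power is the identity, the eigenvalues are \<open>m\<close>-th roots of
  unity, so for \<open>m = 2 k\<close> a class is a multiset over the \<open>k + 1\<close> roots in the closed upper half plane,
  where \<open>1\<close> and \<open>-1\<close> have weight 1, the others weight 2, and the total weight is \<open>2 n\<close>. The
  multiplicities of \<open>1\<close> and \<open>-1\<close> have the same parity; the two parities contribute the two
  binomial coefficients.\<close>

section \<open>Conjugacy in the orthogonal group\<close>

abbreviation orth :: "nat \<Rightarrow> real mat set" where
  "orth N \<equiv> carrier (orthogonal_group N)"

lemma orthI:
  assumes "A \<in> carrier_mat N N" "transpose_mat A * A = 1\<^sub>m N"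
  shows "A \<in> orth N"
  using assms mat_mult_left_right_inverse[of "transpose_mat A" N A]
  by (auto simp: orthogonal_group_def)

lemma orthD:
  assumes "A \<in> orth N"
  shows "A \<in> carrier_mat N N" "transpose_mat A * A = 1\<^sub>m N" "A * transpose_mat A = 1\<^sub>m N"
  using assms by (auto simp: orthogonal_group_def)

lemma orth_one: "1\<^sub>m N \<in> orth N"
  by (rule orthI) auto

lemma orth_transpose: "A \<in> orth N \<Longrightarrow> transpose_mat A \<in> orth N"
  by (auto simp: orthogonal_group_def)

lemma orth_mult: "A \<in> orth N \<Longrightarrow> B \<in> orth N \<Longrightarrow> A * B \<in> orth N"
  using monoid.m_closed[OF group.is_monoid[OF group_orthogonal_group[of N]], of A B]
  by (simp add: orthogonal_group_def)

lemma orth_cancel: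
  assumes "Q \<in> orth N" "B \<in> carrier_mat N d"
  shows "transpose_mat Q * (Q * B) = B" "Q * (transpose_mat Q * B) = B"
  using orthD[OF assms(1)] assms(2)
  by (simp_all add: assoc_mult_mat[of _ N N _ N _ d, symmetric])

lemma orth_cancel_vec:
  assumes "Q \<in> orth N" "v \<in> carrier_vec N"
  shows "transpose_mat Q *\<^sub>v (Q *\<^sub>v v) = v" "Q *\<^sub>v (transpose_mat Q *\<^sub>v v) = v"
proof -
  note Q = orthD[OF assms(1)]
  have "transpose_mat Q *\<^sub>v (Q *\<^sub>v v) = (transpose_mat Q * Q) *\<^sub>v v"
    by (rule assoc_mult_mat_vec[symmetric]) (use Q assms in auto)
  then show "transpose_mat Q *\<^sub>v (Q *\<^sub>v v) = v"
    unfolding Q using assms by simp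
  have "Q *\<^sub>v (transpose_mat Q *\<^sub>v v) = (Q * transpose_mat Q) *\<^sub>v v"
    by (rule assoc_mult_mat_vec[symmetric]) (use Q assms in auto)
  then show "Q *\<^sub>v (transpose_mat Q *\<^sub>v v) = v"
    unfolding Q using assms by simp
qed

lemma orth_scalar_prod:
  assumes "Q \<in> orth N" "u \<in> carrier_vec N" "v \<in> carrier_vec N"
  shows "(Q *\<^sub>v u) \<bullet> (Q *\<^sub>v v) = u \<bullet> v"
proof -
  note Q = orthD[OF assms(1)]
  have "(Q *\<^sub>v u) \<bullet> (Q *\<^sub>v v) = (transpose_mat Q *\<^sub>v (Q *\<^sub>v u)) \<bullet> v"
    using transpose_vec_mult_scalar[of Q N N v "Q *\<^sub>v u"] Q assms by simp
  also have "transpose_mat Q *\<^sub>v (Q *\<^sub>v u) = u"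
    using assms by (simp add: orth_cancel_vec)
  finally show ?thesis .
qed

text \<open>The transpose stands for the group inverse, so that conjugacy becomes plain matrix
  algebra.\<close>

definition orth_conj :: "nat \<Rightarrow> real mat \<Rightarrow> real mat \<Rightarrow> bool" where
  "orth_conj N A B \<longleftrightarrow> (\<exists>Q\<in>orth N. B = Q * A * transpose_mat Q)"

lemma orth_conj_sym:
  assumes "A \<in> carrier_mat N N" "orth_conj N A B"
  shows "orth_conj N B A"
proof -
  obtain Q where Q: "Q \<in> orth N" and B: "B = Q * A * transpose_mat Q"
    using assms(2) by (auto simp: orth_conj_def)
  note Q' = orthD[OF Q]
  have "transpose_mat Q * B * transpose_mat (transpose_mat Q) = A"
    using Q' assms(1) orth_cancel[OF Q, of "A * (transpose_mat Q * Q)" N]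
    by (simp add: B assoc_mult_mat[of _ N N _ N _ N])
  then show ?thesis
    unfolding orth_conj_def by (metis orth_transpose[OF Q])
qed

lemma orth_conj_trans:
  assumes "A \<in> carrier_mat N N" "orth_conj N A B" "orth_conj N B C"
  shows "orth_conj N A C"
proof -
  obtain P Q where P: "P \<in> orth N" and Q: "Q \<in> orth N"
    and B: "B = P * A * transpose_mat P" and C: "C = Q * B * transpose_mat Q"
    using assms by (auto simp: orth_conj_def)
  have "C = (Q * P) * A * transpose_mat (Q * P)"
    using orthD(1)[OF P] orthD(1)[OF Q] assms(1)
    by (simp add: B C transpose_mult[of _ N N _ N] assoc_mult_mat[of _ N N _ N _ N])
  then show ?thesis
    using orth_mult[OF Q P] unfolding orth_conj_def by blast
qed

lemma orth_conj_similar: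
  assumes "A \<in> carrier_mat N N" "orth_conj N A B"
  shows "similar_mat B A"
proof -
  obtain Q where Q: "Q \<in> orth N" and B: "B = Q * A * transpose_mat Q"
    using assms(2) by (auto simp: orth_conj_def)
  show ?thesis
    by (rule similar_matI[where P = Q and Q = "transpose_mat Q" and n = N])
      (use orthD[OF Q] assms(1) B in auto)
qed

section \<open>Block diagonal sums\<close>

definition dsum :: "'a::zero mat \<Rightarrow> 'a mat \<Rightarrow> 'a mat" where
  "dsum A B = four_block_mat A (0\<^sub>m (dim_row A) (dim_col B)) (0\<^sub>m (dim_row B) (dim_col A)) B"

lemma dsum_carrier:
  "A \<in> carrier_mat d d \<Longrightarrow> B \<in> carrier_mat e e \<Longrightarrow> dsum A B \<in> carrier_mat (d + e) (d + e)"
  by (auto simp: dsum_def)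

lemma dsum_mult:
  fixes A :: "'a::semiring_0 mat"
  assumes "A \<in> carrier_mat d d" "B \<in> carrier_mat e e" "C \<in> carrier_mat d d" "D \<in> carrier_mat e e"
  shows "dsum A B * dsum C D = dsum (A * C) (B * D)"
  unfolding dsum_def using assms
  by (subst mult_four_block_mat[of _ d d _ e _ e _ _ d _ e]) auto

lemma dsum_transpose:
  "A \<in> carrier_mat d d \<Longrightarrow> B \<in> carrier_mat e e \<Longrightarrow>
    transpose_mat (dsum A B) = dsum (transpose_mat A) (transpose_mat B)"
  unfolding dsum_def by (subst transpose_four_block_mat[of _ d d _ e _ e]) auto

lemma dsum_one: "dsum (1\<^sub>m d) (1\<^sub>m e) = 1\<^sub>m (d + e)"
  unfolding dsum_def by (rule eq_matI) auto

lemma dsum_eq_iff: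
  assumes "A \<in> carrier_mat d d" "B \<in> carrier_mat e e" "C \<in> carrier_mat d d" "D \<in> carrier_mat e e"
  shows "dsum A B = dsum C D \<longleftrightarrow> A = C \<and> B = D"
proof
  assume eq: "dsum A B = dsum C D"
  have "A $$ (i, j) = C $$ (i, j)" if "i < d" "j < d" for i j
    using arg_cong[OF eq, of "\<lambda>M. M $$ (i, j)"] assms that by (auto simp: dsum_def)
  moreover have "B $$ (i, j) = D $$ (i, j)" if "i < e" "j < e" for i j
    using arg_cong[OF eq, of "\<lambda>M. M $$ (d + i, d + j)"] assms that by (auto simp: dsum_def)
  ultimately show "A = C \<and> B = D"
    using assms by (auto intro!: eq_matI)
qed simp

lemma dsum_pow:
  fixes A :: "'a::semiring_1 mat"
  assumes "A \<in> carrier_mat d d" "B \<in> carrier_mat e e"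
  shows "dsum A B ^\<^sub>m i = dsum (A ^\<^sub>m i) (B ^\<^sub>m i)"
  using pow_four_block_mat[OF assms, of i] assms by (simp add: dsum_def)

lemma orth_dsum:
  assumes "A \<in> orth d" "B \<in> orth e"
  shows "dsum A B \<in> orth (d + e)"
proof (rule orthI)
  show "dsum A B \<in> carrier_mat (d + e) (d + e)"
    using assms by (intro dsum_carrier orthD)
  show "transpose_mat (dsum A B) * dsum A B = 1\<^sub>m (d + e)"
    using orthD[OF assms(1)] orthD[OF assms(2)]
    by (simp add: dsum_transpose dsum_mult[of _ d _ e] dsum_one)
qed

text \<open>The characteristic matrix is again block diagonal. This factorisation later allows a
  common block to be cancelled.\<close>

lemma char_poly_dsum:
  fixes A :: "'a::idom mat"
  assumes "A \<in> carrier_mat d d" "B \<in> carrier_mat e e"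
  shows "char_poly (dsum A B) = char_poly A * char_poly B"
proof -
  have "char_poly_matrix (dsum A B) =
      four_block_mat (char_poly_matrix A) (0\<^sub>m d e) (0\<^sub>m e d) (char_poly_matrix B)"
    unfolding char_poly_matrix_def dsum_def
    by (rule eq_matI) (use assms in auto)
  then show ?thesis
    unfolding char_poly_def
    by (simp add: det_four_block_mat_lower_left_zero[of _ d _ e] assms)
qed

lemma orth_conj_dsum:
  assumes "A \<in> carrier_mat d d" "B \<in> carrier_mat e e" "orth_conj e B C"
  shows "orth_conj (d + e) (dsum A B) (dsum A C)"
proof -
  obtain Q where Q: "Q \<in> orth e" and C: "C = Q * B * transpose_mat Q"
    using assms(3) by (auto simp: orth_conj_def)
  have "dsum (1\<^sub>m d) Q * dsum A B * transpose_mat (dsum (1\<^sub>m d) Q) = dsum A C"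
    using assms(1,2) orthD(1)[OF Q]
    by (simp add: C dsum_transpose[of _ d _ e] dsum_mult[of _ d _ e])
  then show ?thesis
    unfolding orth_conj_def using orth_dsum[OF orth_one Q] by metis
qed

section \<open>Reflections, orthonormal families and invariant subspaces\<close>

text \<open>The Householder matrix of the hyperplane orthogonal to \<open>w\<close>; dividing by
  \<open>w \<bullet> w\<close> spares a normalisation of \<open>w\<close>.\<close>

definition reflection :: "nat \<Rightarrow> real vec \<Rightarrow> real mat" where
  "reflection N w = mat N N (\<lambda>(i, j). (if i = j then 1 else 0) - 2 * w $ i * w $ j / (w \<bullet> w))"

lemma reflection_mult_vec:
  assumes "w \<in> carrier_vec N" "x \<in> carrier_vec N"
  shows "reflection N w *\<^sub>v x = x - (2 * (w \<bullet> x) / (w \<bullet> w)) \<cdot>\<^sub>v w"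
proof (rule eq_vecI)
  fix i assume "i < dim_vec (x - (2 * (w \<bullet> x) / (w \<bullet> w)) \<cdot>\<^sub>v w)"
  then have i: "i < N" using assms by auto
  have "(reflection N w *\<^sub>v x) $ i = (\<Sum>j<N. ((if i = j then 1 else 0) - 2 * w $ i * w $ j / (w \<bullet> w)) * x $ j)"
    using i assms by (simp add: reflection_def scalar_prod_def atLeast0LessThan)
  also have "\<dots> = (\<Sum>j<N. if i = j then x $ j else 0) - (\<Sum>j<N. 2 * w $ i / (w \<bullet> w) * (w $ j * x $ j))"
    unfolding sum_subtractf[symmetric] by (intro sum.cong) (auto simp: algebra_simps)
  also have "(\<Sum>j<N. 2 * w $ i / (w \<bullet> w) * (w $ j * x $ j)) = 2 * w $ i / (w \<bullet> w) * (w \<bullet> x)"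
    using assms unfolding sum_distrib_left[symmetric] scalar_prod_def[of w x]
    by (simp add: atLeast0LessThan)
  also have "(\<Sum>j<N. if i = j then x $ j else 0) = x $ i"
    using i by simp
  finally show "(reflection N w *\<^sub>v x) $ i = (x - (2 * (w \<bullet> x) / (w \<bullet> w)) \<cdot>\<^sub>v w) $ i"
    using i assms by simp
qed (use assms in \<open>simp add: reflection_def\<close>)

lemma orth_reflection:
  assumes w: "w \<in> carrier_vec N" and ww: "w \<bullet> w \<noteq> 0"
  shows "reflection N w \<in> orth N"
proof (rule orthI)
  show c: "reflection N w \<in> carrier_mat N N"
    by (simp add: reflection_def)
  have col: "col (reflection N w) j = unit_vec N j - (2 * w $ j / (w \<bullet> w)) \<cdot>\<^sub>v w" if "j < N" for j
    using w that by (intro eq_vecI) (auto simp: reflection_def)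
  show "transpose_mat (reflection N w) * reflection N w = 1\<^sub>m N"
  proof (rule eq_matI)
    fix i j assume "i < dim_row (1\<^sub>m N)" "j < dim_col (1\<^sub>m N)"
    then have ij: "i < N" "j < N" by auto
    have "(transpose_mat (reflection N w) * reflection N w) $$ (i, j)
        = (unit_vec N i - (2 * w $ i / (w \<bullet> w)) \<cdot>\<^sub>v w) \<bullet> (unit_vec N j - (2 * w $ j / (w \<bullet> w)) \<cdot>\<^sub>v w)"
      using ij c col by simp
    \<comment> \<open>The two cross terms add up to
      \<open>- 4 * w $ i * w $ j / (w \<bullet> w)\<close> and cancel against the quadratic
      term.\<close>
    also have "\<dots> = unit_vec N i \<bullet> unit_vec N j"
      using w ij ww
      by (simp add: minus_scalar_prod_distrib[of _ N] scalar_prod_minus_distrib[of _ N])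
    finally show "(transpose_mat (reflection N w) * reflection N w) $$ (i, j) = 1\<^sub>m N $$ (i, j)"
      using ij by simp
  qed (use c in auto)
qed

text \<open>The reflection along \<open>x - y\<close> works, since the two vectors have equal
  length. It fixes everything orthogonal to \<open>x - y\<close>; the last clause records this so
  that basis vectors already placed stay in place in \<open>orthonormal_extend\<close>.\<close>

lemma exists_reflection:
  assumes x: "x \<in> carrier_vec N" and y: "y \<in> carrier_vec N" and xy: "x \<bullet> x = y \<bullet> y"
  shows "\<exists>H\<in>orth N. H *\<^sub>v x = y \<and> (\<forall>z\<in>carrier_vec N. z \<bullet> x = z \<bullet> y \<longrightarrow> H *\<^sub>v z = z)"
proof (cases "x = y")
  case True
  then show ?thesis
    using x by (intro bexI[of _ "1\<^sub>m N"] orth_one) auto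
next
  case False
  define w where "w = x - y"
  have w: "w \<in> carrier_vec N" using x y by (simp add: w_def)
  have "w \<noteq> 0\<^sub>v N"
  proof
    assume "w = 0\<^sub>v N"
    then have w0: "w $ i = 0" if "i < N" for i
      using that by simp
    have "x $ i = y $ i" if "i < N" for i
      using w0[OF that] that x y by (simp add: w_def)
    with False show False using x y by (auto intro: eq_vecI)
  qed
  then have ww: "w \<bullet> w \<noteq> 0"
    using w by (simp add: flip: conjugate_square_eq_0_vec[OF w])
  \<comment> \<open>Equal lengths make the reflection coefficient equal to 1, so \<open>x\<close>
    goes to \<open>x - w\<close>, which is \<open>y\<close>.\<close>
  have "w \<bullet> w = 2 * (w \<bullet> x)"
    using x y xy comm_scalar_prod[OF x y]
    by (simp add: w_def minus_scalar_prod_distrib[of _ N] scalar_prod_minus_distrib[of _ N])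
  then have "2 * (w \<bullet> x) / (w \<bullet> w) = 1" using ww by simp
  then have "reflection N w *\<^sub>v x = x - 1 \<cdot>\<^sub>v w"
    using reflection_mult_vec[OF w x] by simp
  also have "\<dots> = y" using x y by (auto simp: w_def)
  finally have "reflection N w *\<^sub>v x = y" .
  moreover have "reflection N w *\<^sub>v z = z" if z: "z \<in> carrier_vec N" and "z \<bullet> x = z \<bullet> y" for z
  proof -
    have "w \<bullet> z = 0"
      using that x y comm_scalar_prod[OF z] by (simp add: w_def minus_scalar_prod_distrib[of _ N])
    then show ?thesis
      using reflection_mult_vec[OF w z] w z by auto
  qed
  ultimately show ?thesis
    using orth_reflection[OF w ww] by blast
qed

text \<open>Induction on \<open>d\<close>: pulled back by the current \<open>Q\<close>, the next
  vector becomes a unit vector \<open>w\<close> orthogonal to the first \<open>d\<close> coordinate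
  vectors. A reflection \<open>H\<close> from the next coordinate vector to \<open>w\<close> fixes
  those, so \<open>Q * H\<close> keeps the columns already placed and adds the new one.\<close>

lemma orthonormal_extend:
  assumes "\<And>j. j < d \<Longrightarrow> v j \<in> carrier_vec N"
    and "\<And>i j. i < d \<Longrightarrow> j < d \<Longrightarrow> v i \<bullet> v j = (if i = j then 1 else 0)"
  shows "d \<le> N \<and> (\<exists>Q\<in>orth N. \<forall>j<d. Q *\<^sub>v unit_vec N j = v j)"
  using assms
proof (induction d)
  case 0
  then show ?case using orth_one[of N] by blast
next
  case (Suc d)
  then obtain Q where dN: "d \<le> N" and Q: "Q \<in> orth N"
    and Qv: "\<And>j. j < d \<Longrightarrow> Q *\<^sub>v unit_vec N j = v j"
    by (metis less_SucI)
  note Q' = orthD[OF Q]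
  define w where "w = transpose_mat Q *\<^sub>v v d"
  have vd: "v d \<in> carrier_vec N" using Suc.prems by simp
  have w: "w \<in> carrier_vec N" using Q' vd by (simp add: w_def)
  have Qw: "Q *\<^sub>v w = v d"
    using orth_cancel_vec[OF Q vd] by (simp add: w_def)
  have ww: "w \<bullet> w = 1"
    using orth_scalar_prod[OF Q w w] Qw Suc.prems(2)[of d d] by simp
  have w0: "w $ j = 0" if "j < d" for j
  proof -
    have "unit_vec N j \<bullet> w = v j \<bullet> v d"
      using orth_scalar_prod[OF Q _ w, of "unit_vec N j"] Qv[OF that] Qw by simp
    then show ?thesis
      using Suc.prems(2)[of j d] that dN w by simp
  qed
  \<comment> \<open>The first \<open>d\<close> coordinates of \<open>w\<close> vanish, so
    \<open>d = N\<close> would contradict its length 1. Hence there is a next coordinate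
    vector.\<close>
  have "d \<noteq> N"
  proof
    assume "d = N"
    then have "w = 0\<^sub>v N" using w w0 by auto
    then show False using ww by simp
  qed
  then have d: "d < N" using dN by simp
  obtain H where H: "H \<in> orth N" "H *\<^sub>v unit_vec N d = w"
    and Hz: "\<And>z. z \<in> carrier_vec N \<Longrightarrow> z \<bullet> unit_vec N d = z \<bullet> w \<Longrightarrow> H *\<^sub>v z = z"
    using exists_reflection[of "unit_vec N d" N w] w ww d by auto
  have "(Q * H) *\<^sub>v unit_vec N j = v j" if "j < Suc d" for j
  proof (cases "j = d")
    case True
    then show ?thesis
      using Q' orthD(1)[OF H(1)] H(2) Qw by (simp add: assoc_mult_mat_vec[of _ N N _ N])
  next
    case False
    then have "j < d" using that by simp
    then have "H *\<^sub>v unit_vec N j = unit_vec N j"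
      using w0 w d by (intro Hz) auto
    then show ?thesis
      using Q' orthD(1)[OF H(1)] Qv[OF \<open>j < d\<close>] by (simp add: assoc_mult_mat_vec[of _ N N _ N])
  qed
  then show ?case
    using orth_mult[OF Q H(1)] d by auto
qed

text \<open>The columns of \<open>V\<close> are an orthonormal basis of an invariant subspace and
  \<open>R\<close> is the matrix of the restriction. In an orthonormal basis extending them,
  \<open>A\<close> becomes block upper triangular, and orthogonality kills the off-diagonal
  block.\<close>

lemma invariant_subspace_dsum:
  assumes A: "A \<in> orth N" and R: "R \<in> carrier_mat d d" and V: "V \<in> carrier_mat N d"
    and VV: "transpose_mat V * V = 1\<^sub>m d" and AV: "A * V = V * R"
  shows "R \<in> orth d \<and> d \<le> N \<and> (\<exists>A'\<in>orth (N - d). orth_conj N A (dsum R A'))"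
proof -
  note A' = orthD[OF A]
  have "d \<le> N \<and> (\<exists>Q\<in>orth N. \<forall>j<d. Q *\<^sub>v unit_vec N j = col V j)"
  proof (rule orthonormal_extend)
    show "col V i \<bullet> col V j = (if i = j then 1 else 0)" if "i < d" "j < d" for i j
      using arg_cong[OF VV, of "\<lambda>M. M $$ (i, j)"] that V by simp
  qed (use V in auto)
  then obtain Q where dN: "d \<le> N" and Q: "Q \<in> orth N"
    and Qv: "\<And>j. j < d \<Longrightarrow> Q *\<^sub>v unit_vec N j = col V j"
    by blast
  note Q' = orthD[OF Q]
  \<comment> \<open>The first \<open>d\<close> columns of the identity: multiplying by
    \<open>E\<close> on the right extracts the first \<open>d\<close> columns.\<close>
  define E :: "real mat" where "E = mat N d (\<lambda>(i, j). if i = j then 1 else 0)"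
  have E: "E \<in> carrier_mat N d" by (simp add: E_def)
  have QE: "Q * E = V"
  proof (rule eq_matI)
    fix i j assume "i < dim_row V" "j < dim_col V"
    then have ij: "i < N" "j < d" using V by auto
    have "col E j = unit_vec N j" using ij dN by (intro eq_vecI) (auto simp: E_def)
    then have "(Q * E) $$ (i, j) = (Q *\<^sub>v unit_vec N j) $ i" using ij Q' E by simp
    then show "(Q * E) $$ (i, j) = V $$ (i, j)" using Qv[OF ij(2)] ij V by simp
  qed (use Q' E V in auto)
  define B where "B = transpose_mat Q * A * Q"
  have B: "B \<in> orth N" unfolding B_def by (intro orth_mult orth_transpose A Q)
  note B' = orthD[OF B]
  have "B * E = transpose_mat Q * (A * (Q * E))"
    using A' Q' E by (simp add: B_def assoc_mult_mat[of _ N N _ N _ N] assoc_mult_mat[of _ N N _ N _ d])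
  also have "\<dots> = transpose_mat Q * (Q * (E * R))"
    using Q' E R by (simp add: QE AV flip: assoc_mult_mat[of Q N N E d R d])
  also have "\<dots> = E * R" using orth_cancel[OF Q, of "E * R" d] E R by simp
  finally have BE: "B * E = E * R" .
  \<comment> \<open>\<open>B * E = E * R\<close> says that the first \<open>d\<close> columns of
    \<open>B\<close> are \<open>R\<close> on top of zeros.\<close>
  have ent: "B $$ (i, j) = (if i < d then R $$ (i, j) else 0)" if "i < N" "j < d" for i j
  proof -
    have c: "col E j = unit_vec N j" using that dN by (intro eq_vecI) (auto simp: E_def)
    have r: "row E i = (if i < d then unit_vec d i else 0\<^sub>v d)"
      using that by (intro eq_vecI) (auto simp: E_def)
    have "B $$ (i, j) = (B * E) $$ (i, j)"
      using that B' E c dN by simp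
    also have "\<dots> = row E i \<bullet> col R j" unfolding BE using that E R by simp
    also have "\<dots> = (if i < d then R $$ (i, j) else 0)" unfolding r using that R by simp
    finally show ?thesis .
  qed
  obtain B1 B2 B3 B4 where spl: "split_block B d d = (B1, B2, B3, B4)"
    by (cases "split_block B d d") auto
  define e where "e = N - d"
  have N: "N = d + e" using dN by (simp add: e_def)
  have "dim_row B = d + e" "dim_col B = d + e" using B' N by auto
  note sb = split_block[OF spl this]
  have B1: "B1 = R"
    using spl R ent N by (auto simp: split_block_def Let_def)
  have B3: "B3 = 0\<^sub>m e d"
    using spl ent N B' by (auto simp: split_block_def Let_def)
  have Beq: "B = four_block_mat R B2 (0\<^sub>m e d) B4" using sb(5) B1 B3 by simp
  \<comment> \<open>Comparing blocks with the identity gives in turn that \<open>R\<close> is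
    orthogonal, that \<open>transpose_mat R * B2 = 0\<close> and hence \<open>B2 = 0\<close>, and
    that \<open>B4\<close> is orthogonal.\<close>
  have "transpose_mat B * B = four_block_mat (transpose_mat R * R) (transpose_mat R * B2)
      (transpose_mat B2 * R) (transpose_mat B2 * B2 + transpose_mat B4 * B4)"
    unfolding Beq using sb R
    by (subst transpose_four_block_mat[of _ d d _ e _ e])
      (auto simp: mult_four_block_mat[of _ d d _ e _ e _ _ d _ e])
  then have eq: "four_block_mat (transpose_mat R * R) (transpose_mat R * B2)
      (transpose_mat B2 * R) (transpose_mat B2 * B2 + transpose_mat B4 * B4) = 1\<^sub>m (d + e)"
    using B'(2) N by simp
  have "transpose_mat R * R = 1\<^sub>m d"
  proof (rule eq_matI)
    fix i j assume "i < dim_row (1\<^sub>m d)" "j < dim_col (1\<^sub>m d)"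
    then show "(transpose_mat R * R) $$ (i, j) = 1\<^sub>m d $$ (i, j)"
      using arg_cong[OF eq, of "\<lambda>M. M $$ (i, j)"] R by simp
  qed (use R in auto)
  then have RO: "R \<in> orth d" by (rule orthI[OF R])
  have "transpose_mat R * B2 = 0\<^sub>m d e"
  proof (rule eq_matI)
    fix i j assume ij: "i < dim_row (0\<^sub>m d e)" "j < dim_col (0\<^sub>m d e)"
    then show "(transpose_mat R * B2) $$ (i, j) = 0\<^sub>m d e $$ (i, j)"
      using arg_cong[OF eq, of "\<lambda>M. M $$ (i, d + j)"] R sb by simp
  qed (use R sb in auto)
  then have B2: "B2 = 0\<^sub>m d e"
    using orth_cancel(2)[OF RO sb(2)] R by simp
  have "transpose_mat B4 * B4 = 1\<^sub>m e"
  proof (rule eq_matI)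
    fix i j assume ij: "i < dim_row (1\<^sub>m e)" "j < dim_col (1\<^sub>m e)"
    then show "(transpose_mat B4 * B4) $$ (i, j) = 1\<^sub>m e $$ (i, j)"
      using arg_cong[OF eq, of "\<lambda>M. M $$ (d + i, d + j)"] R sb B2 by simp
  qed (use sb in auto)
  then have B4: "B4 \<in> orth e" using sb by (intro orthI)
  have "B = dsum R B4" using Beq B2 R sb by (simp add: dsum_def)
  moreover have "orth_conj N A B"
    using orth_transpose[OF Q] unfolding orth_conj_def B_def by (metis transpose_transpose)
  ultimately show ?thesis using RO dN B4 by (auto simp: e_def)
qed

section \<open>Splitting off an eigenvalue\<close>

definition block_dim :: "complex \<Rightarrow> nat" where
  "block_dim z = (if Im z = 0 then 1 else 2)"

text \<open>A ring embedding of the complex numbers, geometrically a rotation only when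
  \<open>cmod z = 1\<close>. The signs match the action of a real matrix on the real and imaginary
  parts of an eigenvector.\<close>

definition rotation :: "complex \<Rightarrow> real mat" where
  "rotation z = mat 2 2 (\<lambda>(i, j). if i = j then Re z else if i = 0 then Im z else - Im z)"

definition real_block :: "complex \<Rightarrow> real mat" where
  "real_block z = (if Im z = 0 then mat 1 1 (\<lambda>_. Re z) else rotation z)"

lemma real_block_carrier: "real_block z \<in> carrier_mat (block_dim z) (block_dim z)"
  by (simp add: real_block_def block_dim_def rotation_def)

lemma block_dim_pos: "0 < block_dim z"
  by (simp add: block_dim_def)

text \<open>Since \<open>A\<close> is real, the eigenvector equation separates into its real and
  imaginary parts entry by entry.\<close>

lemma mult_complex_eigenvector:
  fixes A :: "real mat"
  assumes A: "A \<in> carrier_mat N N" and z: "z \<in> carrier_vec N"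
    and ev: "map_mat complex_of_real A *\<^sub>v z = l \<cdot>\<^sub>v z"
  shows "A *\<^sub>v map_vec Re z = Re l \<cdot>\<^sub>v map_vec Re z - Im l \<cdot>\<^sub>v map_vec Im z"
    and "A *\<^sub>v map_vec Im z = Im l \<cdot>\<^sub>v map_vec Re z + Re l \<cdot>\<^sub>v map_vec Im z"
proof -
  have s: "(\<Sum>j<N. complex_of_real (A $$ (i, j)) * z $ j) = l * z $ i" if "i < N" for i
    using arg_cong[OF ev, of "\<lambda>v. v $ i"] that A z
    by (simp add: scalar_prod_def atLeast0LessThan)
  show "A *\<^sub>v map_vec Re z = Re l \<cdot>\<^sub>v map_vec Re z - Im l \<cdot>\<^sub>v map_vec Im z"
  proof (rule eq_vecI)
    fix i assume "i < dim_vec (Re l \<cdot>\<^sub>v map_vec Re z - Im l \<cdot>\<^sub>v map_vec Im z)"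
    then have i: "i < N" using z by simp
    show "(A *\<^sub>v map_vec Re z) $ i = (Re l \<cdot>\<^sub>v map_vec Re z - Im l \<cdot>\<^sub>v map_vec Im z) $ i"
      using arg_cong[OF s[OF i], of Re] i A z
      by (simp add: scalar_prod_def atLeast0LessThan)
  qed (use A z in auto)
  show "A *\<^sub>v map_vec Im z = Im l \<cdot>\<^sub>v map_vec Re z + Re l \<cdot>\<^sub>v map_vec Im z"
  proof (rule eq_vecI)
    fix i assume "i < dim_vec (Im l \<cdot>\<^sub>v map_vec Re z + Re l \<cdot>\<^sub>v map_vec Im z)"
    then have i: "i < N" using z by simp
    show "(A *\<^sub>v map_vec Im z) $ i = (Im l \<cdot>\<^sub>v map_vec Re z + Re l \<cdot>\<^sub>v map_vec Im z) $ i"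
      using arg_cong[OF s[OF i], of Im] i A z
      by (simp add: scalar_prod_def atLeast0LessThan algebra_simps)
  qed (use A z in auto)
qed

lemma split_off_real:
  assumes A: "A \<in> orth N" and u: "u \<in> carrier_vec N" "u \<noteq> 0\<^sub>v N" and Au: "A *\<^sub>v u = c \<cdot>\<^sub>v u"
  shows "mat 1 1 (\<lambda>_. c) \<in> orth 1 \<and> 1 \<le> N \<and> (\<exists>A'\<in>orth (N - 1). orth_conj N A (dsum (mat 1 1 (\<lambda>_. c)) A'))"
proof -
  have uu: "u \<bullet> u > 0"
    using u conjugate_square_greater_0_vec[of u N] by simp
  define V where "V = mat N 1 (\<lambda>(i, j). u $ i / sqrt (u \<bullet> u))"
  have V: "V \<in> carrier_mat N 1" by (simp add: V_def)
  have colV: "col V 0 = (1 / sqrt (u \<bullet> u)) \<cdot>\<^sub>v u"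
    using u by (intro eq_vecI) (auto simp: V_def)
  show ?thesis
  proof (rule invariant_subspace_dsum[OF A _ V])
    show "transpose_mat V * V = 1\<^sub>m 1"
    proof (rule eq_matI)
      fix i j assume "i < dim_row (1\<^sub>m 1)" "j < dim_col (1\<^sub>m 1)"
      then show "(transpose_mat V * V) $$ (i, j) = 1\<^sub>m 1 $$ (i, j)"
        using V u uu by (simp add: colV)
    qed (use V in auto)
    show "A * V = V * mat 1 1 (\<lambda>_. c)"
    proof (rule eq_matI)
      fix i j assume "i < dim_row (V * mat 1 1 (\<lambda>_. c))" "j < dim_col (V * mat 1 1 (\<lambda>_. c))"
      then have i: "i < N" "j = 0" using V by auto
      have "(A * V) $$ (i, j) = (A *\<^sub>v u) $ i / sqrt (u \<bullet> u)"
        using i V u orthD(1)[OF A] by (simp add: colV)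
      also have "\<dots> = c * u $ i / sqrt (u \<bullet> u)" unfolding Au using i u by simp
      also have "\<dots> = (V * mat 1 1 (\<lambda>_. c)) $$ (i, j)"
        using i by (simp add: V_def scalar_prod_def)
      finally show "(A * V) $$ (i, j) = (V * mat 1 1 (\<lambda>_. c)) $$ (i, j)" .
    qed (use V orthD(1)[OF A] in auto)
  qed auto
qed

text \<open>Here \<open>u\<close> and \<open>v\<close> are the real and imaginary parts of an eigenvector for the eigenvalue \<open>c + \<i> s\<close>.\<close>
lemma eigenvector_parts_orthogonal:
  assumes A: "A \<in> orth N" and u: "u \<in> carrier_vec N" and v: "v \<in> carrier_vec N"
    and Au: "A *\<^sub>v u = c \<cdot>\<^sub>v u - s \<cdot>\<^sub>v v" and Av: "A *\<^sub>v v = s \<cdot>\<^sub>v u + c \<cdot>\<^sub>v v"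
    and s: "s \<noteq> 0" and uv0: "u \<noteq> 0\<^sub>v N \<or> v \<noteq> 0\<^sub>v N"
  shows "u \<bullet> u = v \<bullet> v" "u \<bullet> v = 0"
proof -
  define a b d where "a = u \<bullet> u" and "b = v \<bullet> v" and "d = u \<bullet> v"
  have vu: "v \<bullet> u = d" using u v comm_scalar_prod d_def by metis
  \<comment> \<open>\<open>A\<close> preserves the three inner products \<open>a\<close>,
    \<open>d\<close> and \<open>b\<close>; expanding them gives three equations linear in these
    unknowns.\<close>
  have 1: "a = c * (c * a - s * d) - s * (c * d - s * b)"
    using orth_scalar_prod[OF A u u] u v vu unfolding Au
    by (simp add: minus_scalar_prod_distrib[of _ N] scalar_prod_minus_distrib[of _ N] a_def b_def d_def)
  have 2: "d = s * (c * a - s * d) + c * (c * d - s * b)"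
    using orth_scalar_prod[OF A u v] u v vu unfolding Au Av
    by (simp add: minus_scalar_prod_distrib[of _ N] scalar_prod_add_distrib[of _ N] a_def b_def d_def)
  have 3: "b = s * (s * a + c * d) + c * (s * d + c * b)"
    using orth_scalar_prod[OF A v v] u v vu unfolding Av
    by (simp add: add_scalar_prod_distrib[of _ N] scalar_prod_add_distrib[of _ N] a_def b_def d_def)
  have "a + b > 0"
    using uv0 u v conjugate_square_greater_0_vec[of u N] conjugate_square_greater_0_vec[of v N]
      conjugate_square_ge_0_vec[of u] conjugate_square_ge_0_vec[of v]
    by (auto simp: a_def b_def)
  \<comment> \<open>The sum of equations 1 and 3, which puts the eigenvalue on the unit
    circle.\<close>
  moreover have "(a + b) * (c\<^sup>2 + s\<^sup>2 - 1) = 0"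
  proof -
    have "(a + b) * (c\<^sup>2 + s\<^sup>2 - 1) = (c * (c * a - s * d) - s * (c * d - s * b))
        + (s * (s * a + c * d) + c * (s * d + c * b)) - (a + b)"
      by (simp add: power2_eq_square algebra_simps)
    then show ?thesis using 1 3 by simp
  qed
  ultimately have cs: "c\<^sup>2 + s\<^sup>2 = 1" by simp
  \<comment> \<open>Given \<open>c\<^sup>2 + s\<^sup>2 = 1\<close>, equations 1 and 2 are divisible
    by \<open>s\<close>; what remains is a homogeneous linear system in \<open>b - a\<close> and
    \<open>d\<close>.\<close>
  have "s * (s * (b - a) - 2 * c * d) = (c * (c * a - s * d) - s * (c * d - s * b)) - (c\<^sup>2 + s\<^sup>2) * a"
    "s * (2 * s * d - c * (a - b)) = (c\<^sup>2 + s\<^sup>2) * d - (s * (c * a - s * d) + c * (c * d - s * b))"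
    by (simp_all add: power2_eq_square algebra_simps)
  then have "s * (s * (b - a) - 2 * c * d) = 0" "s * (2 * s * d - c * (a - b)) = 0"
    unfolding cs using 1 2 by simp_all
  then have 4: "s * (b - a) = 2 * c * d" "2 * s * d = c * (a - b)"
    using s by auto
  show "u \<bullet> u = v \<bullet> v" "u \<bullet> v = 0"
  proof -
    \<comment> \<open>Elimination: these combinations isolate \<open>b - a\<close> and
      \<open>d\<close>, and their right-hand sides vanish.\<close>
    have "(c\<^sup>2 + s\<^sup>2) * (b - a) = c * (2 * s * d) - c * (c * (a - b)) + s * (s * (b - a) - 2 * c * d)"
      "2 * ((c\<^sup>2 + s\<^sup>2) * d) = s * (2 * s * d - c * (a - b)) - c * (s * (b - a) - 2 * c * d)"
      by (simp_all add: power2_eq_square algebra_simps)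
    then show "u \<bullet> u = v \<bullet> v" "u \<bullet> v = 0"
      unfolding cs 4 by (simp_all add: a_def b_def d_def)
  qed
qed

text \<open>The parts \<open>u\<close> and \<open>v\<close> are orthogonal and of equal length, so
  dividing both by that length gives an orthonormal basis of an invariant plane on which
  \<open>A\<close> acts by \<open>R\<close>.\<close>

lemma split_off_complex:
  assumes A: "A \<in> orth N" and u: "u \<in> carrier_vec N" and v: "v \<in> carrier_vec N"
    and uv0: "u \<noteq> 0\<^sub>v N \<or> v \<noteq> 0\<^sub>v N"
    and Au: "A *\<^sub>v u = c \<cdot>\<^sub>v u - s \<cdot>\<^sub>v v" and Av: "A *\<^sub>v v = s \<cdot>\<^sub>v u + c \<cdot>\<^sub>v v"
    and s: "s \<noteq> 0"
  defines "R \<equiv> mat 2 2 (\<lambda>(i, j). if i = j then c else if i = 0 then s else - s)"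
  shows "R \<in> orth 2 \<and> 2 \<le> N \<and> (\<exists>A'\<in>orth (N - 2). orth_conj N A (dsum R A'))"
proof -
  note vu = eigenvector_parts_orthogonal[OF A u v Au Av s uv0]
  have uu: "u \<bullet> u > 0"
    using u v uv0 vu(1) conjugate_square_greater_0_vec[of u N] conjugate_square_greater_0_vec[of v N]
    by auto
  have vu0: "v \<bullet> u = 0" using u v vu(2) comm_scalar_prod by metis
  define V where "V = mat N 2 (\<lambda>(i, j). (if j = 0 then u else v) $ i / sqrt (u \<bullet> u))"
  have V: "V \<in> carrier_mat N 2" by (simp add: V_def)
  have colV: "col V j = (1 / sqrt (u \<bullet> u)) \<cdot>\<^sub>v (if j = 0 then u else v)" if "j < 2" for j
    using u v that by (intro eq_vecI) (auto simp: V_def)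
  have R: "R \<in> carrier_mat 2 2" by (simp add: R_def)
  show ?thesis
  proof (rule invariant_subspace_dsum[OF A R V])
    show "transpose_mat V * V = 1\<^sub>m 2"
    proof (rule eq_matI)
      fix i j assume "i < dim_row (1\<^sub>m 2)" "j < dim_col (1\<^sub>m 2)"
      then show "(transpose_mat V * V) $$ (i, j) = 1\<^sub>m 2 $$ (i, j)"
        using V u v uu vu vu0 by (auto simp: colV)
    qed (use V in auto)
    show "A * V = V * R"
    proof (rule eq_matI)
      fix i j assume "i < dim_row (V * R)" "j < dim_col (V * R)"
      then have i: "i < N" and j: "j < 2" using V R by auto
      have "(A * V) $$ (i, j) = (A *\<^sub>v (if j = 0 then u else v)) $ i / sqrt (u \<bullet> u)"
        using i j V u v orthD(1)[OF A] by (simp add: colV)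
      also have "\<dots> = (if j = 0 then c * u $ i - s * v $ i else s * u $ i + c * v $ i) / sqrt (u \<bullet> u)"
        using i u v Au Av by simp
      also have "\<dots> = (V * R) $$ (i, j)"
        using i j by (auto simp: V_def R_def scalar_prod_def numeral_2_eq_2 less_Suc_eq
          add_divide_distrib diff_divide_distrib mult.commute)
      finally show "(A * V) $$ (i, j) = (V * R) $$ (i, j)" .
    qed (use V R orthD(1)[OF A] in auto)
  qed
qed

lemma split_off_eigenvalue:
  assumes A: "A \<in> orth N" and l: "eigenvalue (map_mat complex_of_real A) l"
  shows "real_block l \<in> orth (block_dim l) \<and> block_dim l \<le> N \<and>
    (\<exists>A'\<in>orth (N - block_dim l). orth_conj N A (dsum (real_block l) A'))"
proof -
  note A' = orthD[OF A]
  obtain z where z: "z \<in> carrier_vec N" "z \<noteq> 0\<^sub>v N"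
    and ev: "map_mat complex_of_real A *\<^sub>v z = l \<cdot>\<^sub>v z"
    using l A' by (auto simp: eigenvalue_def eigenvector_def)
  define u v where "u = map_vec Re z" and "v = map_vec Im z"
  have u: "u \<in> carrier_vec N" and v: "v \<in> carrier_vec N" using z by (auto simp: u_def v_def)
  note Auv = mult_complex_eigenvector[OF A'(1) z(1) ev, folded u_def v_def]
  have uv0: "u \<noteq> 0\<^sub>v N \<or> v \<noteq> 0\<^sub>v N"
  proof (rule ccontr)
    assume "\<not> (u \<noteq> 0\<^sub>v N \<or> v \<noteq> 0\<^sub>v N)"
    then have 0: "u $ i = 0" "v $ i = 0" if "i < N" for i using that by auto
    have "z $ i = 0" if "i < N" for i
      using 0[OF that] that z(1) by (simp add: u_def v_def complex_eq_iff)
    then show False using z by auto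
  qed
  show ?thesis
  proof (cases "Im l = 0")
    case True
    \<comment> \<open>For real \<open>l\<close> both parts satisfy the eigenvalue equation, and
      whichever is nonzero can be used.\<close>
    have "A *\<^sub>v u = Re l \<cdot>\<^sub>v u" "A *\<^sub>v v = Re l \<cdot>\<^sub>v v" using Auv True u v by auto
    then show ?thesis
      using split_off_real[OF A u] split_off_real[OF A v] uv0 True
      by (auto simp: real_block_def block_dim_def)
  next
    case False
    then show ?thesis
      using split_off_complex[OF A u v uv0 Auv False] by (simp add: real_block_def block_dim_def rotation_def)
  qed
qed

section \<open>Classes are determined by the characteristic polynomial\<close>

text \<open>One direction is invariance under similarity. The other is a strong induction on
  \<open>N\<close>, because each step lowers the dimension by 1 or 2.\<close>

lemma orth_conj_iff_char_poly:
  assumes "A \<in> orth N" "B \<in> orth N"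
  shows "orth_conj N A B \<longleftrightarrow> char_poly A = char_poly B"
proof
  show "char_poly A = char_poly B" if "orth_conj N A B"
    using char_poly_similar[OF orth_conj_similar[OF _ that]] orthD(1)[OF assms(1)] by simp
  show "orth_conj N A B" if "char_poly A = char_poly B"
    using assms that
  proof (induction N arbitrary: A B rule: less_induct)
    case (less N)
    note A = orthD(1)[OF less.prems(1)] and B = orthD(1)[OF less.prems(2)]
    show ?case
    proof (cases "N = 0")
      case True
      have "B = A" using A B True by (intro eq_matI) auto
      then show ?thesis using orth_one[of N] A by (auto simp: orth_conj_def intro!: bexI[of _ "1\<^sub>m N"])
    next
      case False
      let ?p = "map_poly complex_of_real (char_poly A)"
      have "degree ?p = N" using degree_monic_char_poly[OF A] by simp
      then obtain l where l: "poly ?p l = 0"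
        using False fundamental_theorem_of_algebra[of ?p] constant_degree[of ?p] by auto
      have l': "eigenvalue (map_mat complex_of_real A) l" "eigenvalue (map_mat complex_of_real B) l"
        using l less.prems(3) A B
        by (simp_all add: eigenvalue_root_char_poly[of _ N] of_real_hom.char_poly_hom[of _ N])
      let ?d = "block_dim l"
      obtain A' where dN: "?d \<le> N" and A': "A' \<in> orth (N - ?d)" and cA: "orth_conj N A (dsum (real_block l) A')"
        using split_off_eigenvalue[OF less.prems(1) l'(1)] by auto
      obtain B' where B': "B' \<in> orth (N - ?d)" and cB: "orth_conj N B (dsum (real_block l) B')"
        using split_off_eigenvalue[OF less.prems(2) l'(2)] by auto
      note cp = char_poly_dsum[OF real_block_carrier orthD(1)]
      have "char_poly (real_block l) * char_poly A' = char_poly (real_block l) * char_poly B'"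
        using char_poly_similar[OF orth_conj_similar[OF A cA]]
          char_poly_similar[OF orth_conj_similar[OF B cB]] less.prems(3) cp[OF A'] cp[OF B'] by simp
      \<comment> \<open>The polynomial of the block is monic, hence nonzero, and cancels in the
        integral domain of real polynomials.\<close>
      moreover have "char_poly (real_block l) \<noteq> 0"
        using degree_monic_char_poly[OF real_block_carrier[of l]] by auto
      ultimately have "char_poly A' = char_poly B'" by simp
      then have "orth_conj (N - ?d) A' B'"
        using less.IH[OF _ A' B'] dN block_dim_pos[of l] by simp
      from orth_conj_dsum[OF real_block_carrier[of l] orthD(1)[OF A'] this]
      have "orth_conj N (dsum (real_block l) A') (dsum (real_block l) B')" using dN by simp
      then show ?thesis
        using orth_conj_trans[OF A cA] orth_conj_sym[OF B cB] orth_conj_trans A by metis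
    qed
  qed
qed

section \<open>Characteristic polynomials of torsion elements\<close>

text \<open>The minimal polynomial of \<open>z\<close> over the reals, coefficients listed from the
  constant term upwards.\<close>

definition block_poly :: "complex \<Rightarrow> real poly" where
  "block_poly z = (if Im z = 0 then [:- Re z, 1:] else [:(cmod z)\<^sup>2, - 2 * Re z, 1:])"

lemma char_poly_real_block: "char_poly (real_block z) = block_poly z"
proof (cases "Im z = 0")
  case True
  then show ?thesis
    by (simp add: real_block_def block_poly_def char_poly_defs det_single)
next
  case False
  \<comment> \<open>Splitting into four 1 by 1 blocks, which commute, makes the block determinant
    formula applicable.\<close>
  have "char_poly_matrix (real_block z) = four_block_mat (mat 1 1 (\<lambda>_. [:- Re z, 1:])) (mat 1 1 (\<lambda>_. [:- Im z:]))
      (mat 1 1 (\<lambda>_. [:Im z:])) (mat 1 1 (\<lambda>_. [:- Re z, 1:]))"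
    using False by (intro eq_matI) (auto simp: real_block_def rotation_def char_poly_matrix_def numeral_2_eq_2 less_Suc_eq)
  moreover have "det \<dots> = det (mat 1 1 (\<lambda>_. [:- Re z, 1:]) * mat 1 1 (\<lambda>_. [:- Re z, 1:])
      - mat 1 1 (\<lambda>_. [:- Im z:]) * mat 1 1 (\<lambda>_. [:Im z:]))"
    by (rule det_four_block_mat[where n = 1]) (auto simp: scalar_prod_def mult.commute intro!: eq_matI)
  moreover have "\<dots> = [:- Re z, 1:] * [:- Re z, 1:] - [:- Im z:] * [:Im z:]"
    by (subst det_single) (auto simp: scalar_prod_def)
  ultimately show ?thesis
    using False by (simp add: char_poly_def block_poly_def cmod_power2[unfolded power2_eq_square] power2_eq_square)
qed

text \<open>For non-real \<open>z\<close> the polynomial factors as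
  \<open>(w - z) * (w - cnj z)\<close>; for real \<open>z\<close> the two alternatives
  coincide.\<close>

lemma poly_block_poly: "poly (map_poly complex_of_real (block_poly z)) w = 0 \<longleftrightarrow> w = z \<or> w = cnj z"
proof (cases "Im z = 0")
  case True
  then show ?thesis
    by (auto simp: block_poly_def complex_eq_iff)
next
  case False
  have "(cmod z)\<^sup>2 = Re z * Re z + Im z * Im z"
    unfolding cmod_power2 by (simp add: power2_eq_square)
  then have "complex_of_real ((cmod z)\<^sup>2) + w * (w - complex_of_real (2 * Re z)) = (w - z) * (w - cnj z)"
    by (simp add: complex_eq_iff algebra_simps)
  then have "poly (map_poly complex_of_real (block_poly z)) w = (w - z) * (w - cnj z)"
    using False by (simp add: block_poly_def)
  then show ?thesis by simp
qed

lemma rotation_pow: "rotation z ^\<^sub>m i = rotation (z ^ i)"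
proof (induction i)
  case 0
  show ?case by (auto simp: rotation_def intro!: eq_matI)
next
  case (Suc i)
  have "rotation (z ^ i) * rotation z = rotation (z ^ i * z)"
    by (intro eq_matI)
      (auto simp: rotation_def scalar_prod_def numeral_2_eq_2 less_Suc_eq algebra_simps)
  then show ?case using Suc by (simp add: mult.commute)
qed

lemma mat_1_pow: "mat 1 1 (\<lambda>_. r :: real) ^\<^sub>m i = mat 1 1 (\<lambda>_. r ^ i)"
  by (induction i) (auto simp: scalar_prod_def mult.commute intro!: eq_matI)

lemma mat_1_eq_one_iff: "mat 1 1 (\<lambda>_. r :: real) = 1\<^sub>m 1 \<longleftrightarrow> r = 1"
proof
  assume eq: "mat 1 1 (\<lambda>_. r) = 1\<^sub>m 1"
  show "r = 1"
    using arg_cong[OF eq, of "\<lambda>M. M $$ (0, 0)"] by simp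
qed (auto intro!: eq_matI)

lemma rotation_eq_one_iff: "rotation z = 1\<^sub>m 2 \<longleftrightarrow> z = 1"
proof
  assume eq: "rotation z = 1\<^sub>m 2"
  show "z = 1"
    using arg_cong[OF eq, of "\<lambda>M. M $$ (0, 0)"] arg_cong[OF eq, of "\<lambda>M. M $$ (0, 1)"]
    by (simp add: rotation_def complex_eq_iff)
qed (auto simp: rotation_def intro!: eq_matI)

text \<open>In either dimension the block represents \<open>z\<close> faithfully and
  multiplicatively, so the power can be taken in the complex numbers.\<close>

lemma real_block_pow_eq_one_iff: "real_block z ^\<^sub>m i = 1\<^sub>m (block_dim z) \<longleftrightarrow> z ^ i = 1"
proof (cases "Im z = 0")
  case True
  then obtain r where "z = complex_of_real r"
    by (metis complex_is_Real_iff Reals_cases)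
  then show ?thesis
    unfolding real_block_def block_dim_def
    by (simp add: mat_1_pow[simplified] mat_1_eq_one_iff[simplified] flip: of_real_power)
next
  case False
  then have "real_block z = rotation z" by (simp add: real_block_def)
  then show ?thesis
    using False by (simp add: rotation_pow rotation_eq_one_iff block_dim_def)
qed

lemma orth_real_block:
  assumes "cmod z = 1"
  shows "real_block z \<in> orth (block_dim z)"
proof (rule orthI[OF real_block_carrier])
  have 1: "Re z * Re z + Im z * Im z = 1"
    using assms cmod_power2[of z] by (simp add: power2_eq_square)
  then show "transpose_mat (real_block z) * real_block z = 1\<^sub>m (block_dim z)"
    by (intro eq_matI)
      (auto simp: real_block_def rotation_def block_dim_def scalar_prod_def numeral_2_eq_2 less_Suc_eq split: if_splits)
qed

lemma orth_conj_pow_one: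
  assumes "A \<in> carrier_mat N N" "orth_conj N A B" "A ^\<^sub>m i = 1\<^sub>m N"
  shows "B ^\<^sub>m i = 1\<^sub>m N"
proof -
  obtain P Q where w: "similar_mat_wit B A P Q"
    using orth_conj_similar[OF assms(1,2)] by (auto simp: similar_mat_def)
  have "N = dim_row B"
    using assms(2) by (auto simp: orth_conj_def dest!: orthD(1))
  note w' = similar_mat_witD[OF this w]
  have "B ^\<^sub>m i = P * A ^\<^sub>m i * Q" by (rule similar_mat_wit_pow_id[OF w])
  also have "\<dots> = 1\<^sub>m N" unfolding assms(3) using w' by simp
  finally show ?thesis .
qed

section \<open>Torsion elements and multisets of roots of unity\<close>

definition torsion_orth :: "nat \<Rightarrow> nat \<Rightarrow> real mat set" where
  "torsion_orth N m = {A \<in> orth N. A ^\<^sub>m m = 1\<^sub>m N}"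

text \<open>Non-real eigenvalues of a real matrix come in conjugate pairs, each represented by its
  member in the upper half plane.\<close>

definition upper_roots :: "nat \<Rightarrow> complex set" where
  "upper_roots m = {z. z ^ m = 1 \<and> Im z \<ge> 0}"

lemma torsion_dsum:
  assumes "z ^ m = 1" "m > 0" "A \<in> torsion_orth N m"
  shows "dsum (real_block z) A \<in> torsion_orth (block_dim z + N) m"
proof -
  have "cmod z = 1" using assms(1,2) power_eq_1_iff by blast
  then show ?thesis
    using assms orth_dsum[OF orth_real_block, of z A N] dsum_pow[OF real_block_carrier orthD(1), of A N z m]
      real_block_pow_eq_one_iff[of z m] dsum_one[of "block_dim z" N]
    by (simp add: torsion_orth_def)
qed

text \<open>Realisation of every multiset: the block diagonal sum of the blocks of its members,
  built one block at a time.\<close>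

lemma exists_torsion_char_poly:
  assumes "m > 0" "set_mset M \<subseteq> upper_roots m"
  shows "\<exists>A\<in>torsion_orth (\<Sum>z\<in>#M. block_dim z) m. char_poly A = (\<Prod>z\<in>#M. block_poly z)"
  using assms(2)
proof (induction M)
  case empty
  have "char_poly (1\<^sub>m 0 :: real mat) = 1"
    by (simp add: char_poly_defs)
  then show ?case
    by (intro bexI[of _ "1\<^sub>m 0"]) (auto simp: torsion_orth_def orth_one)
next
  case (add z M)
  then obtain A where A: "A \<in> torsion_orth (\<Sum>z\<in>#M. block_dim z) m" "char_poly A = (\<Prod>z\<in>#M. block_poly z)"
    by auto
  have "A \<in> carrier_mat (\<Sum>z\<in>#M. block_dim z) (\<Sum>z\<in>#M. block_dim z)"
    using A(1) by (auto simp: torsion_orth_def dest: orthD)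
  then show ?case
    using add.prems A torsion_dsum[OF _ assms(1) A(1), of z]
    by (intro bexI[of _ "dsum (real_block z) A"])
      (auto simp: upper_roots_def char_poly_dsum[OF real_block_carrier] char_poly_real_block)
qed

text \<open>Blocks are split off until the dimension is 0. The torsion condition passes to both
  summands, which forces every eigenvalue split off to be a root of unity.\<close>

lemma torsion_char_poly:
  assumes "A \<in> torsion_orth N m"
  shows "\<exists>M. set_mset M \<subseteq> upper_roots m \<and> (\<Sum>z\<in>#M. block_dim z) = N \<and> char_poly A = (\<Prod>z\<in>#M. block_poly z)"
  using assms
proof (induction N arbitrary: A rule: less_induct)
  case (less N)
  have AO: "A \<in> orth N" and Am: "A ^\<^sub>m m = 1\<^sub>m N"
    using less.prems by (auto simp: torsion_orth_def)
  note A = orthD(1)[OF AO]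
  show ?case
  proof (cases "N = 0")
    case True
    have "char_poly A = 1" using A True by (simp add: char_poly_def)
    then show ?thesis using True by (intro exI[of _ "{#}"]) auto
  next
    case False
    let ?p = "map_poly complex_of_real (char_poly A)"
    have "degree ?p = N" using degree_monic_char_poly[OF A] by simp
    then obtain l0 where l0: "poly ?p l0 = 0"
      using False fundamental_theorem_of_algebra[of ?p] constant_degree[of ?p] by auto
    \<comment> \<open>The polynomial has real coefficients, so a root in the lower half plane may be
      replaced by its conjugate.\<close>
    define l where "l = (if Im l0 \<ge> 0 then l0 else cnj l0)"
    have "poly ?p (cnj l0) = cnj (poly ?p l0)"
      by (rule poly_cnj_real[symmetric]) simp
    then have l: "poly ?p l = 0" and Iml: "Im l \<ge> 0"
      using l0 by (auto simp: l_def)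
    have ev: "eigenvalue (map_mat complex_of_real A) l"
      using l A by (simp add: eigenvalue_root_char_poly[of _ N] of_real_hom.char_poly_hom[of _ N])
    let ?d = "block_dim l"
    obtain A' where dN: "?d \<le> N" and A': "A' \<in> orth (N - ?d)" and cA: "orth_conj N A (dsum (real_block l) A')"
      using split_off_eigenvalue[OF AO ev] by auto
    \<comment> \<open>The \<open>m\<close>-th power of the conjugated matrix is the identity as
      well, and it is computed blockwise.\<close>
    have "dsum (real_block l ^\<^sub>m m) (A' ^\<^sub>m m) = dsum (1\<^sub>m ?d) (1\<^sub>m (N - ?d))"
      using orth_conj_pow_one[OF A cA Am] dN
      by (simp add: dsum_pow[OF real_block_carrier orthD(1)[OF A']] dsum_one)
    then have "real_block l ^\<^sub>m m = 1\<^sub>m ?d" "A' ^\<^sub>m m = 1\<^sub>m (N - ?d)"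
      using real_block_carrier[of l] orthD(1)[OF A']
      by (simp_all add: dsum_eq_iff[of _ ?d _ "N - ?d"] pow_carrier_mat)
    then have lm: "l \<in> upper_roots m" and "A' \<in> torsion_orth (N - ?d) m"
      using A' Iml by (auto simp: real_block_pow_eq_one_iff upper_roots_def torsion_orth_def)
    then obtain M where M: "set_mset M \<subseteq> upper_roots m" "(\<Sum>z\<in>#M. block_dim z) = N - ?d"
      "char_poly A' = (\<Prod>z\<in>#M. block_poly z)"
      using less.IH[of "N - ?d" A'] dN block_dim_pos[of l] by auto
    have "char_poly A = block_poly l * char_poly A'"
      using char_poly_similar[OF orth_conj_similar[OF A cA]]
      by (simp add: char_poly_dsum[OF real_block_carrier orthD(1)[OF A']] char_poly_real_block)
    then show ?thesis
      using M lm dN by (intro exI[of _ "add_mset l M"]) auto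
  qed
qed

lemma map_poly_of_real_mult:
  "map_poly complex_of_real (p * q) = map_poly complex_of_real p * map_poly complex_of_real q"
proof -
  interpret map_poly_comm_ring_hom complex_of_real ..
  show ?thesis by (rule hom_mult)
qed

text \<open>In the closed upper half plane \<open>w = cnj z\<close> is possible only if both are
  real and equal, so there the factor of \<open>z\<close> vanishes at \<open>z\<close>
  alone.\<close>

lemma poly_prod_block_poly:
  assumes "set_mset M \<subseteq> {z. Im z \<ge> 0}" "Im w \<ge> 0"
  shows "poly (map_poly complex_of_real (\<Prod>z\<in>#M. block_poly z)) w = 0 \<longleftrightarrow> w \<in># M"
  using assms(1)
proof (induction M)
  case (add z M)
  have "w = cnj z \<Longrightarrow> w = z"
    using add.prems assms(2) by (auto simp: complex_eq_iff)
  then show ?case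
    using add by (auto simp: map_poly_of_real_mult poly_block_poly)
qed simp

text \<open>Each member of \<open>M\<close> is a root of the common product and therefore lies in
  \<open>M'\<close> too. Its factor is nonzero and cancels, and induction applies to the
  rest.\<close>

lemma prod_block_poly_inj:
  assumes "set_mset M \<subseteq> {z. Im z \<ge> 0}" "set_mset M' \<subseteq> {z. Im z \<ge> 0}"
    and "(\<Prod>z\<in>#M. block_poly z) = (\<Prod>z\<in>#M'. block_poly z)"
  shows "M = M'"
  using assms
proof (induction M arbitrary: M')
  case empty
  \<comment> \<open>A member of \<open>M'\<close> would be a root of the constant polynomial
    1.\<close>
  then show ?case
    using poly_prod_block_poly[of M'] by (metis empty_iff multi_nonempty_split poly_prod_block_poly set_mset_empty
        mem_Collect_eq subsetD union_single_eq_member)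
next
  case (add z M)
  have z: "Im z \<ge> 0" using add.prems by simp
  have "z \<in># M'"
    using poly_prod_block_poly[OF add.prems(1) z] poly_prod_block_poly[OF add.prems(2) z] add.prems(3) by simp
  then obtain M'' where M': "M' = add_mset z M''" by (metis mset_add)
  have "block_poly z \<noteq> 0" by (simp add: block_poly_def)
  then have "(\<Prod>z\<in>#M. block_poly z) = (\<Prod>z\<in>#M''. block_poly z)"
    using add.prems(3) M' by simp
  then have "M = M''" using add.prems M' by (intro add.IH) auto
  then show ?case using M' by simp
qed

text \<open>Among the \<open>2 * k\<close> roots only 1 and -1 are real, and conjugation swaps the
  two open half planes, so each of these contains \<open>k - 1\<close> roots.\<close>

lemma card_upper_roots:
  assumes "k > 0"
  shows "card (upper_roots (2 * k)) = k + 1"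
proof -
  define U L where "U = {z. z ^ (2 * k) = 1 \<and> Im z > 0}" and "L = {z. z ^ (2 * k) = 1 \<and> Im z < 0}"
  have fin: "finite {z::complex. z ^ (2 * k) = 1}" using assms by (intro finite_roots_unity) auto
  have finU: "finite U" "finite L" by (rule finite_subset[OF _ fin]; auto simp: U_def L_def)+
  have "(cnj z) ^ (2 * k) = 1 \<longleftrightarrow> z ^ (2 * k) = 1" for z
    by (metis complex_cnj_cnj complex_cnj_one complex_cnj_power)
  then have "cnj z \<in> U \<longleftrightarrow> z \<in> L" for z
    by (simp add: U_def L_def)
  then have "L = cnj ` U"
    unfolding set_eq_iff image_iff by (metis complex_cnj_cnj)
  then have "card L = card U" by (simp add: card_image inj_on_def)
  have real: "z ^ (2 * k) = 1 \<and> Im z = 0 \<longleftrightarrow> z = 1 \<or> z = - 1" for z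
  proof
    assume z: "z ^ (2 * k) = 1 \<and> Im z = 0"
    then obtain r where r: "z = complex_of_real r" by (metis complex_is_Real_iff Reals_cases)
    have "cmod z = 1" using z assms power_eq_1_iff[of z "2 * k"] by simp
    then have "r = 1 \<or> r = - 1" using r by auto
    then show "z = 1 \<or> z = - 1" using r by auto
  qed auto
  have "{z::complex. z ^ (2 * k) = 1} = U \<union> L \<union> {1, - 1}"
  proof (rule Set.set_eqI)
    fix z :: complex
    show "z \<in> {z. z ^ (2 * k) = 1} \<longleftrightarrow> z \<in> U \<union> L \<union> {1, - 1}"
      using real[of z] by (cases "Im z" "0 :: real" rule: linorder_cases) (auto simp: U_def L_def)
  qed
  moreover have "upper_roots (2 * k) = U \<union> {1, - 1}"
    using real by (auto simp: U_def upper_roots_def order_le_less)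
  moreover have "card (U \<union> L \<union> {1, - 1}) = card U + card L + 2"
    using finU by (subst card_Un_disjoint; (subst card_Un_disjoint)?) (auto simp: U_def L_def)
  moreover have "card (U \<union> {1, - 1}) = card U + 2"
    using finU by (subst card_Un_disjoint) (auto simp: U_def)
  moreover have "card {z::complex. z ^ (2 * k) = 1} = 2 * k"
    using assms by (intro card_roots_unity_eq) auto
  ultimately show ?thesis using \<open>card L = card U\<close> by simp
qed

section \<open>Counting\<close>

text \<open>Each occurrence of \<open>a\<close> or \<open>b\<close> falls short of weight 2 by
  exactly 1; the additive form avoids subtraction on \<open>nat\<close>.\<close>

lemma weight_plus_counts:
  assumes "a \<noteq> b"
  shows "(\<Sum>x\<in>#M. if x = a \<or> x = b then 1 else 2 :: nat) + count M a + count M b = 2 * size M"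
  using assms by (induction M) auto

text \<open>With weight 1 at \<open>a\<close> and \<open>b\<close> and weight 2 elsewhere, every
  element of \<open>X\<close> now contributes 2, so size \<open>N\<close> becomes weight
  \<open>2 * N\<close>.\<close>

definition double_at :: "'a \<Rightarrow> 'a \<Rightarrow> 'a multiset \<Rightarrow> 'a multiset" where
  "double_at a b X = X + replicate_mset (count X a) a + replicate_mset (count X b) b"

text \<open>The two marked points carry multiplicities of equal parity when the weight is even. Even
  multiplicities are halved; odd ones become even after removing one copy of each.\<close>
lemma card_multisets_of_weight:
  fixes S :: "'a set"
  assumes S: "finite S" "a \<in> S" "b \<in> S" and ab: "a \<noteq> b" and n: "n > 0"
  shows "card {M. set_mset M \<subseteq> S \<and> (\<Sum>x\<in>#M. if x = a \<or> x = b then 1 else 2 :: nat) = 2 * n}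
    = (card S + n - 1 choose n) + (card S + (n - 1) - 1 choose (n - 1))"
proof -
  let ?w = "\<lambda>M. \<Sum>x\<in>#M. if x = a \<or> x = b then 1 else 2 :: nat"
  define E where "E N = {M. set_mset M \<subseteq> S \<and> ?w M = 2 * N \<and> even (count M a) \<and> even (count M b)}" for N
  have cnt: "count (double_at a b X) x = (if x = a \<or> x = b then 2 * count X x else count X x)" for X x
    using ab by (auto simp: double_at_def)
  have bij: "bij_betw (double_at a b) (multisets_of_size S N) (E N)" for N
  proof (rule bij_betw_imageI)
    show "inj_on (double_at a b) (multisets_of_size S N)"
    proof (rule inj_onI)
      fix X Y assume eq: "double_at a b X = double_at a b Y"
      show "X = Y"
      proof (rule multiset_eqI)
        fix x show "count X x = count Y x"
          using arg_cong[OF eq, of "\<lambda>M. count M x"] by (auto simp: cnt split: if_splits)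
      qed
    qed
    show "double_at a b ` multisets_of_size S N = E N"
    proof (intro equalityI subsetI)
      fix M assume "M \<in> double_at a b ` multisets_of_size S N"
      then obtain X where X: "set_mset X \<subseteq> S" "size X = N" and M: "M = double_at a b X"
        by (auto simp: multisets_of_size_def)
      have "size M = N + count X a + count X b" by (simp add: M double_at_def X)
      then have "?w M = 2 * N"
        using weight_plus_counts[OF ab, of M] by (simp add: M cnt)
      moreover have "set_mset M \<subseteq> S" using X S by (auto simp: M double_at_def)
      ultimately show "M \<in> E N" by (simp add: E_def M cnt)
    next
      fix M assume M: "M \<in> E N"
      \<comment> \<open>The preimage: the marked multiplicities, even by membership in
        \<open>E N\<close>, are halved.\<close>
      define X where "X = filter_mset (\<lambda>x. x \<noteq> a \<and> x \<noteq> b) M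
        + replicate_mset (count M a div 2) a + replicate_mset (count M b div 2) b"
      have MX: "M = double_at a b X"
        using M ab by (intro multiset_eqI) (auto simp: cnt X_def E_def)
      have XS: "set_mset X \<subseteq> S" using M S by (auto simp: X_def E_def split: if_splits)
      have "size M = size X + count X a + count X b" by (simp add: MX double_at_def)
      then have "?w M = 2 * size X"
        using weight_plus_counts[OF ab, of M] by (simp add: MX cnt)
      then have "size X = N" using M by (simp add: E_def)
      then show "M \<in> double_at a b ` multisets_of_size S N"
        using MX XS by (auto simp: multisets_of_size_def)
    qed
  qed
  have card: "card (E N) = (card S + N - 1 choose N)" for N
    using bij_betw_same_card[OF bij[of N]] card_multisets_of_size[OF S(1)] by simp
  have fin: "finite (E N)" for N
    using bij_betw_finite[OF bij[of N]] finite_multisets_of_size[OF S(1)] by simp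
  let ?f = "\<lambda>M. add_mset a (add_mset b M)"
  have split: "{M. set_mset M \<subseteq> S \<and> ?w M = 2 * n} = E n \<union> ?f ` E (n - 1)" (is "?W = _")
  proof (intro equalityI subsetI)
    fix M assume M: "M \<in> ?W"
    have "2 * n + (count M a + count M b) = 2 * size M"
      using weight_plus_counts[OF ab, of M] M by simp
    then have par: "even (count M a) \<longleftrightarrow> even (count M b)" by presburger
    show "M \<in> E n \<union> ?f ` E (n - 1)"
    proof (cases "even (count M a)")
      case True
      then show ?thesis using M par by (simp add: E_def)
    next
      case False
      then have odd: "odd (count M a)" "odd (count M b)" using par by auto
      then have "a \<in># M" "b \<in># M" by (metis even_zero not_in_iff)+
      then obtain M1 where "M = add_mset a M1" "b \<in># M1"
        using ab by (metis insert_DiffM insert_noteq_member)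
      then obtain M2 where M2: "M = ?f M2" by (metis insert_DiffM)
      \<comment> \<open>Removing one copy each of \<open>a\<close> and \<open>b\<close> lowers the
        weight by 2 and makes both multiplicities even.\<close>
      then have "M2 \<in> E (n - 1)" using M odd ab by (auto simp: E_def)
      then show ?thesis using M2 by blast
    qed
  next
    fix M assume "M \<in> E n \<union> ?f ` E (n - 1)"
    \<comment> \<open>Positivity of \<open>n\<close> ensures \<open>2 * (n - 1) + 2 = 2 * n\<close>
      despite truncated subtraction.\<close>
    then show "M \<in> ?W" using S n by (auto simp: E_def)
  qed
  \<comment> \<open>The parity of the multiplicity of \<open>a\<close> separates the two
    sets.\<close>
  have "card (E n \<union> ?f ` E (n - 1)) = card (E n) + card (?f ` E (n - 1))"
    using fin ab by (intro card_Un_disjoint) (auto simp: E_def)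
  also have "card (?f ` E (n - 1)) = card (E (n - 1))"
    by (rule card_image) (auto simp: inj_on_def)
  finally show ?thesis unfolding split card .
qed

text \<open>Polynomials of torsion elements correspond to multisets of upper roots of weight
  \<open>2 * n\<close>, which \<open>card_multisets_of_weight\<close> counts with 1 and -1 as the
  marked points.\<close>

lemma card_char_poly_torsion:
  assumes "n > 0" "k > 0"
  shows "card (char_poly ` torsion_orth (2 * n) (2 * k)) = (n + k choose k) + (n + k - 1 choose k)"
proof -
  let ?S = "upper_roots (2 * k)"
  let ?W = "{M. set_mset M \<subseteq> ?S \<and> (\<Sum>z\<in>#M. block_dim z) = 2 * n}"
  have cS: "card ?S = k + 1" by (rule card_upper_roots[OF assms(2)])
  have "char_poly ` torsion_orth (2 * n) (2 * k) = (\<lambda>M. \<Prod>z\<in>#M. block_poly z) ` ?W"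
  proof (intro equalityI subsetI)
    fix p assume "p \<in> char_poly ` torsion_orth (2 * n) (2 * k)"
    then show "p \<in> (\<lambda>M. \<Prod>z\<in>#M. block_poly z) ` ?W"
      using torsion_char_poly by fastforce
  next
    fix p assume "p \<in> (\<lambda>M. \<Prod>z\<in>#M. block_poly z) ` ?W"
    then obtain M where "set_mset M \<subseteq> ?S" "(\<Sum>z\<in>#M. block_dim z) = 2 * n" "p = (\<Prod>z\<in>#M. block_poly z)"
      by auto
    then show "p \<in> char_poly ` torsion_orth (2 * n) (2 * k)"
      using exists_torsion_char_poly[of "2 * k" M] assms(2) by force
  qed
  moreover have "inj_on (\<lambda>M. \<Prod>z\<in>#M. block_poly z) ?W"
    by (rule inj_onI, rule prod_block_poly_inj) (auto simp: upper_roots_def)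
  ultimately have "card (char_poly ` torsion_orth (2 * n) (2 * k)) = card ?W"
    by (simp add: card_image)
  also have "?W = {M. set_mset M \<subseteq> ?S \<and> (\<Sum>z\<in>#M. if z = 1 \<or> z = - 1 then 1 else 2) = 2 * n}"
  proof -
    \<comment> \<open>Roots of unity have modulus 1, so the real ones are 1 and -1.\<close>
    have "block_dim z = (if z = 1 \<or> z = - 1 then 1 else 2)" if "z \<in> ?S" for z
    proof -
      have "cmod z = 1"
        using that power_eq_1_iff[of z "2 * k"] assms(2) by (auto simp: upper_roots_def)
      then have "Im z = 0 \<longleftrightarrow> z = 1 \<or> z = - 1"
        by (auto simp: complex_eq_iff cmod_def power2_eq_1_iff)
      then show ?thesis by (simp add: block_dim_def)
    qed
    then have "(\<Sum>z\<in>#M. block_dim z) = (\<Sum>z\<in>#M. if z = 1 \<or> z = - 1 then 1 else 2)" if "set_mset M \<subseteq> ?S" for M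
      using that by (intro arg_cong[of _ _ sum_mset] image_mset_cong) blast
    then show ?thesis by auto
  qed
  also have "card \<dots> = (card ?S + n - 1 choose n) + (card ?S + (n - 1) - 1 choose (n - 1))"
    by (rule card_multisets_of_weight)
      (use assms cS card_ge_0_finite[of ?S] in \<open>auto simp: upper_roots_def complex_eq_iff\<close>)
  \<comment> \<open>There are \<open>k + 1\<close> upper roots, so the upper entries are
    \<open>n + k\<close> and \<open>n + k - 1\<close>; symmetry turns the lower entries
    \<open>n\<close> and \<open>n - 1\<close> into \<open>k\<close>.\<close>
  also have "\<dots> = (n + k choose k) + (n + k - 1 choose k)"
    using assms binomial_symmetric[of n "n + k"] binomial_symmetric[of "n - 1" "n + k - 1"]
    by (simp add: cS add.commute)
  finally show ?thesis .
qed

section \<open>From matrices back to the group and its classes\<close>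

lemma orthogonal_group_mult: "x \<otimes>\<^bsub>orthogonal_group N\<^esub> y = x * y"
  by (simp add: orthogonal_group_def)

lemma orthogonal_group_inv:
  assumes "Q \<in> orth N"
  shows "inv\<^bsub>orthogonal_group N\<^esub> Q = transpose_mat Q"
  by (rule group.inv_equality[OF group_orthogonal_group _ assms orth_transpose[OF assms]])
    (use orthD[OF assms] in \<open>simp add: orthogonal_group_def\<close>)

lemma orthogonal_group_pow:
  assumes "A \<in> orth N"
  shows "A [^]\<^bsub>orthogonal_group N\<^esub> m = A ^\<^sub>m m"
proof -
  interpret group "orthogonal_group N" by (rule group_orthogonal_group)
  show ?thesis
    using orthD(1)[OF assms]
    by (induction m) (simp_all add: orthogonal_group_mult, simp add: orthogonal_group_def)
qed

text \<open>Orbits under conjugation are the classes of \<open>orth_conj N\<close>, which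
  \<open>orth_conj_iff_char_poly\<close> turns into fibres of \<open>char_poly\<close>.\<close>

lemma orbit_orthogonal_group:
  assumes "A \<in> orth N"
  shows "orbit (orthogonal_group N) (\<lambda>g. \<lambda>x\<in>orth N. g \<otimes>\<^bsub>orthogonal_group N\<^esub> x \<otimes>\<^bsub>orthogonal_group N\<^esub>
    inv\<^bsub>orthogonal_group N\<^esub> g) A = {B \<in> orth N. char_poly B = char_poly A}"
proof -
  have "orbit (orthogonal_group N) (\<lambda>g. \<lambda>x\<in>orth N. g \<otimes>\<^bsub>orthogonal_group N\<^esub> x \<otimes>\<^bsub>orthogonal_group N\<^esub>
    inv\<^bsub>orthogonal_group N\<^esub> g) A = {B. orth_conj N A B}"
    using assms
    by (auto simp: orbit_def orth_conj_def orthogonal_group_mult orthogonal_group_inv)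
      (metis orthogonal_group_inv)
  also have "\<dots> = {B \<in> orth N. orth_conj N A B}"
    using assms by (auto simp: orth_conj_def intro!: orth_mult orth_transpose)
  also have "\<dots> = {B \<in> orth N. char_poly B = char_poly A}"
    using orth_conj_iff_char_poly[OF assms] by auto
  finally show ?thesis .
qed

text \<open>Being torsion is invariant under conjugation, so the fibre of \<open>char_poly\<close>
  through a torsion element consists of torsion elements, and counting such classes amounts to
  counting their polynomials.\<close>

lemma num_torsion_classes_eq:
  "num_torsion_classes (orthogonal_group N) m = card (char_poly ` torsion_orth N m)"
proof -
  let ?c = "\<lambda>p. {B \<in> orth N. char_poly B = p}"
  have tors: "{x \<in> orth N. x [^]\<^bsub>orthogonal_group N\<^esub> m = \<one>\<^bsub>orthogonal_group N\<^esub>} = torsion_orth N m"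
    using orthogonal_group_pow[of _ N m] by (auto simp: torsion_orth_def orthogonal_group_def)
  have cc: "conjugacy_classes (orthogonal_group N) = (\<lambda>A. ?c (char_poly A)) ` orth N"
    unfolding conjugacy_classes_def orbits_def using orbit_orthogonal_group by auto
  have closed: "B \<in> torsion_orth N m"
    if "A \<in> torsion_orth N m" "B \<in> orth N" "char_poly B = char_poly A" for A B
    using that orth_conj_iff_char_poly[of A N B] orth_conj_pow_one[OF orthD(1), of A N B m]
    by (auto simp: torsion_orth_def)
  have "{C \<in> conjugacy_classes (orthogonal_group N). C \<subseteq> torsion_orth N m}
      = ?c ` char_poly ` torsion_orth N m"
  proof (intro equalityI subsetI)
    fix C assume "C \<in> {C \<in> conjugacy_classes (orthogonal_group N). C \<subseteq> torsion_orth N m}"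
    then obtain A where "A \<in> orth N" "C = ?c (char_poly A)" "C \<subseteq> torsion_orth N m"
      by (auto simp: cc)
    then show "C \<in> ?c ` char_poly ` torsion_orth N m" by blast
  next
    fix C assume "C \<in> ?c ` char_poly ` torsion_orth N m"
    then obtain A where A: "A \<in> torsion_orth N m" "C = ?c (char_poly A)" by blast
    then have "A \<in> orth N" by (simp add: torsion_orth_def)
    then show "C \<in> {C \<in> conjugacy_classes (orthogonal_group N). C \<subseteq> torsion_orth N m}"
      using A closed by (auto simp: cc)
  qed
  \<comment> \<open>The fibre over \<open>p\<close> is nonempty, and any member of it determines
    \<open>p\<close>.\<close>
  moreover have "inj_on ?c (char_poly ` torsion_orth N m)"
  proof (rule inj_onI)
    fix p q assume "p \<in> char_poly ` torsion_orth N m" and eq: "?c p = ?c q"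
    then obtain A where "A \<in> orth N" "char_poly A = p" by (auto simp: torsion_orth_def)
    then have "A \<in> ?c q" using eq by blast
    then show "p = q" using \<open>char_poly A = p\<close> by simp
  qed
  ultimately show ?thesis
    by (simp add: num_torsion_classes_def tors card_image)
qed

theorem theorem17:
  fixes n m k :: nat
  assumes "n > 0" and "m > 0" and "m = 2 * k"
  shows "num_torsion_classes (orthogonal_group (2 * n)) m
           = (n + m div 2 choose (m div 2)) + (n + m div 2 - 1 choose (m div 2))
         \<and> real ((n + m div 2 choose (m div 2)) + (n + m div 2 - 1 choose (m div 2)))
           = real (n + m div 2 - 1 choose (m div 2)) * ((4 * real n + real m) / (2 * real n))"
proof
  have k: "k > 0" "m div 2 = k" using assms by auto
  show "num_torsion_classes (orthogonal_group (2 * n)) m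
      = (n + m div 2 choose (m div 2)) + (n + m div 2 - 1 choose (m div 2))"
    unfolding num_torsion_classes_eq k(2) assms(3) using card_char_poly_torsion[OF assms(1) k(1)] by simp
  \<comment> \<open>The absorption identity expresses the first binomial coefficient through the
    second with factor \<open>(n + k) / n\<close>; adding 1 to this factor gives
    \<open>(4 * n + 2 * k) / (2 * n)\<close>.\<close>
  have "n * (n + k choose k) = (n + k) * (n + k - 1 choose k)"
    using binomial_absorb_comp[of "n + k" k] by simp
  then have "real n * real (n + k choose k) = (real n + real k) * real (n + k - 1 choose k)"
    by (metis of_nat_add of_nat_mult)
  then show "real ((n + m div 2 choose (m div 2)) + (n + m div 2 - 1 choose (m div 2)))
      = real (n + m div 2 - 1 choose (m div 2)) * ((4 * real n + real m) / (2 * real n))"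
    unfolding k(2) using assms(1,3) by (simp add: field_simps)
qed

end
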